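(* Let $G=(V,E)$ be a finite (or infinite) graph satisfying the exponential curvature dimension inequality $CDE(n,-K)$ with $K\ge 0$, and let $u$ be a positive solution to the heat equation $\partial_t u=\Delta u$ on $V\times(0,\infty)$. Let $a:(0,\infty)\to(0,\infty)$ be a $C^1$ function such that (A1) for all $t>0$, $a(t)>0$ and $a'(t)>0$, and $\lim_{t\to0}a(t)=0$, $\lim_{t\to 0}\frac{a(t)}{a'(t)}=0$; (A2) for any $L>0$, $\frac{a'^2}{a}$ is continuous and integrable on the interval $[0,L]$. Define $$\alpha(t)=1+\frac{2K}{a(t)}\int_0^t a(s)\,ds,\qquad \varphi(t)=nK+\frac{nK^2}{a(t)}\int_0^t a(s)\,ds+\frac{n}{4a(t)}\int_0^t\frac{a'(s)^2}{a(s)}\,ds .$$ Then for all $x\in V$ and all $t>0$, $$\frac{\Gamma(\sqrt u)}{u}-\alpha(t)\frac{\partial_t(\sqrt u)}{\sqrt u}\le\frac12\varphi(t).$$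
   Context: $G=(V,E)$ is a graph with positive edge weights $\omega_{xy}>0$ for $x\sim y$, $\mu:V\to(0,\infty)$ is a measure on $V$, and $\deg(x)=\sum_{y\sim x}\omega_{xy}$. Standing assumptions: $\omega_{min}:=\inf_{e\in E}\omega_e>0$, $D_\omega:=\max_{x\sim y}\frac{\deg(x)}{\omega_{xy}}<\infty$, $D_\mu:=\max_{x\in V}\frac{\deg(x)}{\mu(x)}<\infty$. The $\mu$-Laplacian is $\Delta f(x)=\frac1{\mu(x)}\sum_{y\sim x}\omega_{xy}(f(y)-f(x))$. The gradient form is $\Gamma(f,g)(x)=\frac{1}{2\mu(x)}\sum_{y\sim x}\omega_{xy}(f(y)-f(x))(g(y)-g(x))$, and $\Gamma(f)=\Gamma(f,f)$. For a positive function $f$ put $\widetilde\Gamma_2(f)=\frac12\Delta\Gamma(f)-\Gamma\left(f,\frac{\Delta(f^2)}{2f}\right)$. $G$ satisfies $CDE(n,K')$ (with $K'\in\mathbb R$) if for every vertex $x\in V$ and every positive $f:V\to\mathbb R$ with $\Delta f(x)<0$ one has, at $x$, $\widetilde\Gamma_2(f)\ge\frac1n(\Delta f)^2+K'\,\Gamma(f)$. The heat equation $\partial_tu(x,t)=\Delta u(x,t)$ on $V\times(0,\infty)$ is taken with initial data $u(\cdot,0)=u_0$; the solution is written $u(x,t)=P_tu_0(x)$ with $P_t=e^{t\Delta}$ the heat semigroup. *)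

theory Defs
  imports "HOL-Analysis.Analysis"
begin

text \<open>The vertex set is the whole type \<open>'v\<close>, finite or infinite.  The weight function
  is only meaningful on pairs of adjacent vertices.\<close>

record 'v wgraph =
  adj :: "'v \<Rightarrow> 'v \<Rightarrow> bool"
  weight :: "'v \<Rightarrow> 'v \<Rightarrow> real"
  vmeas :: "'v \<Rightarrow> real"

definition nbrs :: "'v wgraph \<Rightarrow> 'v \<Rightarrow> 'v set" where
  "nbrs G x = {y. adj G x y}"

definition wdeg :: "'v wgraph \<Rightarrow> 'v \<Rightarrow> real" where
  "wdeg G x = (\<Sum>y\<in>nbrs G x. weight G x y)"

text \<open>The three constants are extended reals, so that an infimum or supremum over an empty or
  unbounded family has its usual meaning (\<open>omega_min = \<infinity>\<close> if there are no edges).\<close>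

definition omega_min :: "'v wgraph \<Rightarrow> ereal" where
  "omega_min G = (INF (x, y)\<in>{(x, y). adj G x y}. ereal (weight G x y))"

definition D_omega :: "'v wgraph \<Rightarrow> ereal" where
  "D_omega G = (SUP (x, y)\<in>{(x, y). adj G x y}. ereal (wdeg G x / weight G x y))"

definition D_mu :: "'v wgraph \<Rightarrow> ereal" where
  "D_mu G = (SUP x. ereal (wdeg G x / vmeas G x))"

text \<open>Undirected weighted graphs with the standing assumptions.  Finiteness of the neighbourhoods,
  which for convergent \<open>deg(x)\<close> would follow from \<open>D_omega G < \<infinity>\<close>, has to be explicit because
  sums over infinite sets are \<open>0\<close> in HOL.  Loops are not excluded; they do not contribute to
  the Laplacian or to the gradient form.\<close>

definition weighted_graph :: "'v wgraph \<Rightarrow> bool" where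
  "weighted_graph G \<longleftrightarrow>
     (\<forall>x y. adj G x y \<longrightarrow> adj G y x) \<and>
     (\<forall>x. finite (nbrs G x)) \<and>
     (\<forall>x y. adj G x y \<longrightarrow> weight G x y > 0 \<and> weight G x y = weight G y x) \<and>
     (\<forall>x. vmeas G x > 0) \<and>
     omega_min G > 0 \<and> D_omega G < \<infinity> \<and> D_mu G < \<infinity>"

definition Lap :: "'v wgraph \<Rightarrow> ('v \<Rightarrow> real) \<Rightarrow> 'v \<Rightarrow> real" where
  "Lap G f x = 1 / vmeas G x * (\<Sum>y\<in>nbrs G x. weight G x y * (f y - f x))"

definition Gam :: "'v wgraph \<Rightarrow> ('v \<Rightarrow> real) \<Rightarrow> ('v \<Rightarrow> real) \<Rightarrow> 'v \<Rightarrow> real" where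
  "Gam G f g x =
     1 / (2 * vmeas G x) * (\<Sum>y\<in>nbrs G x. weight G x y * (f y - f x) * (g y - g x))"

definition Gam2_tilde :: "'v wgraph \<Rightarrow> ('v \<Rightarrow> real) \<Rightarrow> 'v \<Rightarrow> real" where
  "Gam2_tilde G f x =
     1 / 2 * Lap G (Gam G f f) x - Gam G f (\<lambda>y. Lap G (\<lambda>z. (f z)\<^sup>2) y / (2 * f y)) x"

definition CDE :: "'v wgraph \<Rightarrow> real \<Rightarrow> real \<Rightarrow> bool" where
  "CDE G n K' \<longleftrightarrow>
     (\<forall>x f. (\<forall>y. f y > 0) \<longrightarrow> Lap G f x < 0 \<longrightarrow>
        Gam2_tilde G f x \<ge> 1 / n * (Lap G f x)\<^sup>2 + K' * Gam G f f x)"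

text \<open>Values of \<open>u\<close> at times \<open>t \<le> 0\<close> are unconstrained.\<close>

definition positive_heat_solution :: "'v wgraph \<Rightarrow> ('v \<Rightarrow> real \<Rightarrow> real) \<Rightarrow> bool" where
  "positive_heat_solution G u \<longleftrightarrow>
     (\<forall>x. \<forall>t>0. u x t > 0 \<and>
        ((\<lambda>s. u x s) has_real_derivative Lap G (\<lambda>y. u y t) x) (at t))"

definition LY_alpha :: "real \<Rightarrow> (real \<Rightarrow> real) \<Rightarrow> real \<Rightarrow> real" where
  "LY_alpha K a t = 1 + 2 * K / a t * integral {0..t} a"

definition LY_phi :: "real \<Rightarrow> real \<Rightarrow> (real \<Rightarrow> real) \<Rightarrow> (real \<Rightarrow> real) \<Rightarrow> real \<Rightarrow> real" where
  "LY_phi n K a a' t =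
     n * K + n * K\<^sup>2 / a t * integral {0..t} a
       + n / (4 * a t) * integral {0..t} (\<lambda>s. (a' s)\<^sup>2 / a s)"

end

theory Submission imports Defs begin

text \<open>Put \<open>f = sqrt u\<close> and \<open>H = 2 a \<Gamma>(f) - a \<alpha> \<Delta>u - a \<phi> u\<close>; the claim is \<open>H \<le> 0\<close>.
  As \<open>\<Delta>u = 2 f \<Delta>f + 2 \<Gamma>(f)\<close> and \<open>(\<Delta> - \<partial>\<^sub>t) \<Gamma>(f)\<close> is twice the modified iterated gradient form of
  \<open>f\<close>, the curvature inequality bounds \<open>(\<Delta> - \<partial>\<^sub>t) H\<close> from below by a perfect square wherever
  \<open>\<Delta>f < 0\<close>, in particular wherever \<open>H > 0\<close>.  On the other hand \<open>(\<Delta> - \<partial>\<^sub>t) H \<le> 0\<close> at a maximum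
  of \<open>H / u\<close>.  No cutoff function is needed on an infinite graph: \<open>H / u \<le> 2 D\<^sub>\<mu> a \<alpha>\<close> because
  \<open>-\<Delta>f \<le> D\<^sub>\<mu> f\<close>, so \<open>H / u\<close> is bounded above and its positive part vanishes uniformly as \<open>t \<rightarrow> 0\<close>,
  and an almost maximal point suffices because \<open>\<Delta>f < 0\<close> at \<open>x\<close> forces \<open>f(y) \<le> D\<^sub>\<omega> f(x)\<close> for
  \<open>y \<sim> x\<close>.\<close>

section \<open>The Laplacian and the gradient form\<close>

text \<open>Termwise this is f(y)^2 - f(x)^2 = 2 f(x) (f(y) - f(x)) + (f(y) - f(x))^2, the discrete
  substitute for the chain rule.\<close>

lemma Lap_power2: "Lap G (\<lambda>y. (f y)\<^sup>2) x = 2 * f x * Lap G f x + 2 * Gam G f f x"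
  unfolding Lap_def Gam_def sum_distrib_left sum.distrib[symmetric]
  by (rule sum.cong) (auto simp: divide_simps power2_eq_square, algebra)

lemma Lap_mult_const: "Lap G (\<lambda>y. c * g y) x = c * Lap G g x"
  unfolding Lap_def
  by (simp add: sum_distrib_left) (simp add: algebra_simps)

lemma Lap_diff: "Lap G (\<lambda>y. g y - h y) x = Lap G g x - Lap G h x"
  unfolding Lap_def
  by (simp add: algebra_simps sum.distrib sum_subtractf add_divide_distrib diff_divide_distrib)

lemma has_real_derivative_Lap:
  assumes "\<And>y. (g y has_real_derivative g' y) (at t)"
  shows "((\<lambda>s. Lap G (\<lambda>y. g y s) x) has_real_derivative Lap G g' x) (at t)"
  unfolding Lap_def
  by (rule derivative_eq_intros assms refl)+ (simp add: mult.commute)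

text \<open>Product rule for a symmetric bilinear form. For \<open>g = sqrt u\<close> along the heat
  flow, \<open>g'\<close> is \<Delta>u / (2 sqrt u), which yields the second term of
  \<open>Gam2_tilde\<close>.\<close>

lemma has_real_derivative_Gam:
  assumes "\<And>y. (g y has_real_derivative g' y) (at t)"
  shows "((\<lambda>s. Gam G (\<lambda>y. g y s) (\<lambda>y. g y s) x) has_real_derivative
    2 * Gam G (\<lambda>y. g y t) g' x) (at t)"
proof -
  have "((\<lambda>s. \<Sum>y\<in>nbrs G x. weight G x y * (g y s - g x s) * (g y s - g x s)) has_real_derivative
      (\<Sum>y\<in>nbrs G x. 2 * (weight G x y * (g y t - g x t) * (g' y - g' x)))) (at t)"
    by (rule derivative_eq_intros assms refl)+ (simp add: algebra_simps)
  from DERIV_cmult[OF this, of "1 / (2 * vmeas G x)"] show ?thesis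
    by (simp add: Gam_def flip: sum_distrib_left)
qed

context
  fixes G :: "'v wgraph"
  assumes G: "weighted_graph G"
begin

lemma finite_nbrs: "finite (nbrs G x)"
  and weight_pos: "y \<in> nbrs G x \<Longrightarrow> weight G x y > 0"
  and vmeas_pos: "vmeas G x > 0"
  using G by (auto simp: weighted_graph_def nbrs_def)

lemma Gam_nonneg: "Gam G f f x \<ge> 0"
  using vmeas_pos[of x] weight_pos unfolding Gam_def mult.assoc
  by (intro mult_nonneg_nonneg sum_nonneg zero_le_square) (auto simp: less_imp_le)

lemma wdeg_le_vmeas:
  obtains D where "D \<ge> 0" "\<And>x. wdeg G x \<le> D * vmeas G x"
proof -
  have "D_mu G \<noteq> \<infinity>" using G by (auto simp: weighted_graph_def)
  then obtain m where m: "D_mu G < ereal (real m)" by (auto simp: less_PInf_Ex_of_nat)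
  have *: "wdeg G x / vmeas G x \<le> real m" for x
  proof -
    have "ereal (wdeg G x / vmeas G x) \<le> D_mu G" unfolding D_mu_def by (rule SUP_upper) simp
    then have "ereal (wdeg G x / vmeas G x) < ereal (real m)" using m by (rule le_less_trans)
    then show ?thesis by simp
  qed
  have "wdeg G x \<le> real m * vmeas G x" for x
    using *[of x] vmeas_pos[of x] by (simp add: field_simps)
  then show ?thesis using that[of "real m"] by simp
qed

lemma wdeg_le_weight:
  obtains W where "\<And>x y. y \<in> nbrs G x \<Longrightarrow> wdeg G x \<le> W * weight G x y"
proof -
  have "D_omega G \<noteq> \<infinity>" using G by (auto simp: weighted_graph_def)
  \<comment> \<open>A natural number also lies above the supremum when there are no edges and
    \<open>D_omega G\<close> is -\<infinity>.\<close>
  then obtain m where m: "D_omega G < ereal (real m)" by (auto simp: less_PInf_Ex_of_nat)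
  have "wdeg G x \<le> real m * weight G x y" if y: "y \<in> nbrs G x" for x y
  proof -
    have "ereal (wdeg G x / weight G x y) \<le> D_omega G"
      unfolding D_omega_def using y by (intro SUP_upper2[of "(x, y)"]) (auto simp: nbrs_def)
    then have "ereal (wdeg G x / weight G x y) < ereal (real m)" using m by (rule le_less_trans)
    then show ?thesis using weight_pos[OF y] by (simp add: field_simps)
  qed
  then show ?thesis using that[of "real m"] by simp
qed

lemma Lap_eq_sum_minus_wdeg:
  "Lap G f x = ((\<Sum>y\<in>nbrs G x. weight G x y * f y) - wdeg G x * f x) / vmeas G x"
  unfolding Lap_def wdeg_def
  by (simp add: right_diff_distrib sum_subtractf sum_distrib_right diff_divide_distrib)

text \<open>Neighbours contribute nonnegatively to the Laplacian, so only the diagonal term -deg(x)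
  f(x) / \<mu>(x) can make it negative.\<close>

lemma neg_Lap_le:
  assumes "\<And>y. f y \<ge> 0" "wdeg G x \<le> D * vmeas G x"
  shows "- Lap G f x \<le> D * f x"
proof -
  have "(\<Sum>y\<in>nbrs G x. weight G x y * f y) \<ge> 0"
    using assms(1) weight_pos by (auto intro!: sum_nonneg simp: less_imp_le)
  moreover have "wdeg G x * f x \<le> D * vmeas G x * f x"
    using assms by (intro mult_right_mono) auto
  ultimately show ?thesis
    using vmeas_pos[of x] by (simp add: Lap_eq_sum_minus_wdeg field_simps)
qed

text \<open>A Harnack inequality between neighbours: one summand is at most the whole weighted sum,
  which superharmonicity at \<open>x\<close> bounds by deg(x) f(x).\<close>

lemma superharmonic_nbr_le:
  assumes "\<And>y. f y \<ge> 0" "Lap G f x \<le> 0" "y \<in> nbrs G x" "wdeg G x \<le> W * weight G x y"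
  shows "f y \<le> W * f x"
proof -
  have "weight G x y * f y \<le> (\<Sum>y\<in>nbrs G x. weight G x y * f y)"
    using assms(1,3) weight_pos finite_nbrs
    by (intro member_le_sum) (auto simp: less_imp_le)
  also have "\<dots> \<le> wdeg G x * f x"
    using assms(2) vmeas_pos[of x] by (simp add: Lap_eq_sum_minus_wdeg field_simps)
  also have "\<dots> \<le> W * weight G x y * f x"
    using assms by (intro mult_right_mono) auto
  finally show ?thesis
    using weight_pos[OF assms(3)] by (simp add: mult.commute mult.left_commute)
qed

text \<open>Controls the error term of \<open>Lap_mult_le\<close> for \<open>v = u = f^2\<close>,
  with a constant independent of the vertex.\<close>

lemma sum_weight_power2_le:
  assumes f: "\<And>y. f y \<ge> 0" "Lap G f x \<le> 0"
    and W: "\<And>y. y \<in> nbrs G x \<Longrightarrow> wdeg G x \<le> W * weight G x y"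
    and D: "wdeg G x \<le> D * vmeas G x"
  shows "(\<Sum>y\<in>nbrs G x. weight G x y * (f y)\<^sup>2) / vmeas G x \<le> W\<^sup>2 * D * (f x)\<^sup>2"
proof -
  have "(\<Sum>y\<in>nbrs G x. weight G x y * (f y)\<^sup>2) \<le> (\<Sum>y\<in>nbrs G x. weight G x y * (W * f x)\<^sup>2)"
    using superharmonic_nbr_le[OF f _ W] f(1) weight_pos
    by (intro sum_mono mult_left_mono power_mono) (auto simp: less_imp_le)
  also have "\<dots> = wdeg G x * (W * f x)\<^sup>2" by (simp add: wdeg_def sum_distrib_right)
  also have "\<dots> \<le> D * vmeas G x * (W * f x)\<^sup>2" by (intro mult_right_mono D) auto
  finally show ?thesis
    using vmeas_pos[of x] by (simp add: field_simps power_mult_distrib)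
qed

text \<open>The maximum principle for the quotient \<open>F\<close> of \<open>v * F\<close> by
  \<open>v\<close>; the \<eta>-term is the price for \<open>x\<close> being only almost
  maximal.\<close>

lemma Lap_mult_le:
  assumes "\<And>y. v y \<ge> 0" "\<And>y. F y \<le> F x + \<eta>"
  shows "Lap G (\<lambda>y. v y * F y) x
    \<le> F x * Lap G v x + \<eta> * ((\<Sum>y\<in>nbrs G x. weight G x y * v y) / vmeas G x)"
proof -
  have "(\<Sum>y\<in>nbrs G x. weight G x y * (v y * F y))
      \<le> (\<Sum>y\<in>nbrs G x. weight G x y * (v y * (F x + \<eta>)))"
    using assms weight_pos by (intro sum_mono mult_left_mono) (auto simp: less_imp_le)
  also have "\<dots> = (F x + \<eta>) * (\<Sum>y\<in>nbrs G x. weight G x y * v y)"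
    by (simp add: sum_distrib_left algebra_simps)
  finally show ?thesis
    using vmeas_pos[of x] by (simp add: Lap_eq_sum_minus_wdeg field_simps)
qed

end

section \<open>Almost maximal points\<close>

text \<open>The supremum over \<open>x\<close> need not be attained; maximising exactly in time at a vertex where
  the supremum is almost attained still gives the correct sign of the time derivative.\<close>

lemma almost_maximum:
  fixes F F' :: "'a \<Rightarrow> real \<Rightarrow> real"
  assumes deriv: "\<And>x t. t > 0 \<Longrightarrow> (F x has_real_derivative F' x t) (at t)"
    and le: "\<And>x t. 0 < t \<Longrightarrow> t \<le> T \<Longrightarrow> F x t \<le> b t"
    and bound: "\<And>t. 0 < t \<Longrightarrow> t \<le> T \<Longrightarrow> b t \<le> M"
    and lim: "(b \<longlongrightarrow> 0) (at_right 0)"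
    and T: "T > 0" and x0: "F x0 T > 0" and \<eta>: "\<eta> > 0"
  obtains x t where "0 < t" "t \<le> T" "F x t > 0" "F' x t \<ge> 0" "\<And>y. F y t \<le> F x t + \<eta>"
proof -
  define S where "S = (SUP (x, t)\<in>UNIV \<times> {0<..T}. F x t)"
  have bdd: "bdd_above ((\<lambda>(x, t). F x t) ` (UNIV \<times> {0<..T}))"
    using order_trans[OF le bound] by (intro bdd_aboveI[of _ M]) auto
  have le_S: "F x t \<le> S" if "0 < t" "t \<le> T" for x t
    unfolding S_def using that by (intro cSUP_upper2[OF bdd, of "(x, t)"]) auto
  have S: "S > 0" using le_S[of T x0] T x0 by simp
  \<comment> \<open>The bound \<eta> gives almost maximality; the bound \<open>S / 2\<close> keeps
    the chosen value positive and above the barrier \<open>b\<close> near time 0.\<close>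
  define \<rho> where "\<rho> = min \<eta> (S / 2)"
  have \<rho>: "\<rho> > 0" "\<rho> \<le> \<eta>" "\<rho> \<le> S / 2" using S \<eta> by (auto simp: \<rho>_def)
  have "S - \<rho> < S" using \<rho> by simp
  then obtain p where "p \<in> UNIV \<times> {0<..T}" "S - \<rho> < (case p of (x, t) \<Rightarrow> F x t)"
    using less_cSUP_iff[OF _ bdd, of "S - \<rho>"] T by (auto simp: S_def[symmetric])
  then obtain x t1 where t1: "0 < t1" "t1 \<le> T" "S - \<rho> < F x t1" by auto
  have "eventually (\<lambda>t. b t < S / 2) (at_right 0)"
    using order_tendstoD(2)[OF lim, of "S / 2"] S by simp
  then obtain d where d: "d > 0" "\<And>t. 0 < t \<Longrightarrow> t < d \<Longrightarrow> b t < S / 2"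
    by (auto simp: eventually_at_right_field)
  \<comment> \<open>At \<delta> the barrier already lies below \<open>S / 2\<close>, so the maximum
    over \<open>{\<delta>..T}\<close> is not at the left end. It may be at \<open>T\<close>, hence
    only the sign of the derivative is obtained, not its vanishing.\<close>
  define \<delta> where "\<delta> = min (d / 2) t1"
  have \<delta>: "0 < \<delta>" "\<delta> \<le> t1" "\<delta> < d" using d t1 by (auto simp: \<delta>_def)
  have "continuous_on {\<delta>..T} (F x)"
    using \<delta> by (intro continuous_at_imp_continuous_on ballI DERIV_isCont[OF deriv]) auto
  then obtain t where t: "t \<in> {\<delta>..T}" "\<And>s. s \<in> {\<delta>..T} \<Longrightarrow> F x s \<le> F x t"
    using continuous_attains_sup[of "{\<delta>..T}" "F x"] \<delta> t1 by auto
  have big: "F x t > S - \<rho>" using t(2)[of t1] t1 \<delta> by simp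
  have "F x \<delta> < S / 2" using le[of \<delta> x] d(2)[of \<delta>] \<delta> t1 by simp
  with big \<rho> have "t \<noteq> \<delta>" by auto
  then have t': "\<delta> < t" "t \<le> T" "0 < t" using t(1) \<delta> by auto
  have nonneg: "F' x t \<ge> 0"
  proof (rule ccontr)
    assume "\<not> F' x t \<ge> 0"
    then obtain e where e: "e > 0" "\<And>h. 0 < h \<Longrightarrow> h < e \<Longrightarrow> F x t < F x (t - h)"
      using DERIV_neg_dec_left[OF deriv[OF t'(3), of x]] by auto
    define h where "h = min (e / 2) (t - \<delta>)"
    have "0 < h" "h < e" "h \<le> t - \<delta>" using e t' by (auto simp: h_def)
    then show False using e(2)[of h] t(2)[of "t - h"] t' by auto
  qed
  show ?thesis
    using that[of t x] t' nonneg big \<rho> S le_S[OF t'(3,2)] by (smt (verit) field_sum_of_halves)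
qed

section \<open>Integrals from the origin\<close>

lemma has_real_derivative_integral_0:
  fixes g :: "real \<Rightarrow> real"
  assumes int: "\<And>L. L > 0 \<Longrightarrow> g integrable_on {0..L}" and cont: "continuous_on {0<..} g"
    and t: "t > 0"
  shows "((\<lambda>s. integral {0..s} g) has_real_derivative g t) (at t)"
proof -
  \<comment> \<open>Cutting at \<open>t/2\<close> keeps away from a possible singularity of
    \<open>g\<close> at 0; only the second piece varies with the endpoint.\<close>
  have "continuous_on {t/2..2*t} g" using t by (intro continuous_on_subset[OF cont]) auto
  then have "((\<lambda>s. integral {t/2..s} g) has_real_derivative g t) (at t within {t/2..2*t})"
    using t by (intro integral_has_real_derivative) auto
  then have "((\<lambda>s. integral {t/2..s} g) has_real_derivative g t) (at t)"
    using t by (subst (asm) at_within_Icc_at) auto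
  then have "((\<lambda>s. integral {0..t/2} g + integral {t/2..s} g) has_real_derivative g t) (at t)"
    by (auto intro!: derivative_eq_intros)
  then show ?thesis
  proof (rule has_field_derivative_transform_within_open[where S = "{t/2<..}"])
    fix s assume "s \<in> {t/2<..}"
    then show "integral {0..t/2} g + integral {t/2..s} g = integral {0..s} g"
      using t by (intro Henstock_Kurzweil_Integration.integral_combine int) auto
  qed (use t in auto)
qed

lemma integral_0_tendsto_0:
  fixes g :: "real \<Rightarrow> real"
  assumes "g integrable_on {0..1}"
  shows "((\<lambda>t. integral {0..t} g) \<longlongrightarrow> 0) (at_right 0)"
proof -
  have "((\<lambda>t. integral {0..t} g) \<longlongrightarrow> integral {0..0} g) (at 0 within {0..1})"
    using indefinite_integral_continuous_1[OF assms] unfolding continuous_on_def by (rule bspec) simp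
  then show ?thesis by (simp add: at_within_Icc_at_right)
qed

lemma integral_0_nonneg:
  fixes g :: "real \<Rightarrow> real"
  assumes "\<And>s. s > 0 \<Longrightarrow> g s \<ge> 0" "g integrable_on {0..t}"
  shows "integral {0..t} g \<ge> 0"
proof -
  \<comment> \<open>The value of \<open>g\<close> at 0 is arbitrary, so it is replaced by 0 on the
    null set \<open>{0}\<close>.\<close>
  let ?h = "\<lambda>s. if s = 0 then 0 else g s"
  have "integral {0..t} g = integral {0..t} ?h"
    by (rule integral_spike[of "{0}"]) auto
  moreover have "?h integrable_on {0..t}"
    by (rule integrable_spike[OF assms(2), of "{0}"]) auto
  then have "integral {0..t} ?h \<ge> 0"
    using assms(1) by (intro integral_nonneg) auto
  ultimately show ?thesis by simp
qed

text \<open>The limit \<open>c\<close> extends \<open>g\<close> continuously to the closed interval,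
  and changing one value does not affect integrability.\<close>

lemma integrable_on_0_if_tendsto:
  fixes g :: "real \<Rightarrow> real"
  assumes cont: "continuous_on {0<..} g" and lim: "(g \<longlongrightarrow> c) (at_right 0)" and L: "L > 0"
  shows "g integrable_on {0..L}"
proof -
  let ?h = "\<lambda>s. if s = 0 then c else g s"
  have *: "(g \<longlongrightarrow> g s) (at s)" if "s > 0" for s
    using cont that by (simp add: continuous_on_eq_continuous_at isCont_def)
  have **: "(?h \<longlongrightarrow> ?h s) (at s)" if "s > 0" for s
  proof -
    have "eventually (\<lambda>r. r > 0) (at s)"
      using that by (intro eventually_at_in_open'[of "{0<..}" s, simplified]) auto
    then have "eventually (\<lambda>r. ?h r = g r) (at s)" by eventually_elim simp
    then show ?thesis using *[OF that] that by (subst filterlim_cong[OF refl refl]) auto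
  qed
  have "(?h \<longlongrightarrow> c) (at_right 0)"
  proof (rule Lim_transform_eventually[OF lim])
    show "eventually (\<lambda>s. g s = ?h s) (at_right 0)"
      using eventually_at_right_less[of "0::real"] by eventually_elim auto
  qed
  then have "continuous_on {0..L} ?h"
    using L ** by (intro continuous_on_IccI) (auto intro: tendsto_within_subset)
  then have "?h integrable_on {0..L}" by (rule integrable_continuous_interval)
  then show ?thesis by (rule integrable_spike[of _ _ "{0}"]) auto
qed

section \<open>The differential Harnack quantity\<close>

text \<open>The coefficients of \<open>Lap G (\<lambda>y. (f y)\<^sup>2) x\<close> and
  \<open>(f x)\<^sup>2\<close> are the derivatives of a \<alpha> and a \<phi>. The first cancels all
  \<Gamma>-terms once the curvature bound is inserted; the second completes the square in
  \<Delta>f.\<close>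

lemma CDE_lower_bound:
  assumes CDE: "CDE G n (- K)" and n: "n > 0" and f: "\<And>y. f y > 0" and neg: "Lap G f x < 0"
    and a: "a > 0"
  shows "4 * a * Gam2_tilde G f x - 2 * a' * Gam G f f x
      + (a' + 2 * K * a) * Lap G (\<lambda>y. (f y)\<^sup>2) x
      + (n * K * a' + n * K\<^sup>2 * a + n / 4 * (a'\<^sup>2 / a)) * (f x)\<^sup>2 \<ge> 0"
proof -
  define X where "X = Lap G f x"
  define Y where "Y = Gam G f f x"
  have "Gam2_tilde G f x \<ge> 1 / n * X\<^sup>2 - K * Y"
    using CDE f neg unfolding CDE_def X_def Y_def by fastforce
  then have "4 * a * Gam2_tilde G f x \<ge> 4 * a * (1 / n * X\<^sup>2 - K * Y)"
    using a by (intro mult_left_mono) auto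
  moreover have "4 * a * (1 / n * X\<^sup>2 - K * Y) - 2 * a' * Y + (a' + 2 * K * a) * (2 * f x * X + 2 * Y)
      + (n * K * a' + n * K\<^sup>2 * a + n / 4 * (a'\<^sup>2 / a)) * (f x)\<^sup>2
      = 4 * a / n * (X + n * (a' + 2 * K * a) / (4 * a) * f x)\<^sup>2"
    using a n by (simp add: field_simps power2_eq_square)
  moreover have "4 * a / n * (X + n * (a' + 2 * K * a) / (4 * a) * f x)\<^sup>2 \<ge> 0"
    using a n by simp
  ultimately show ?thesis unfolding Lap_power2 X_def[symmetric] Y_def[symmetric] by linarith
qed

text \<open>Here \<open>A\<close> and \<open>B\<close> stand for \<open>a \<alpha>\<close> and \<open>a \<phi>\<close>.  The summand \<open>\<epsilon>\<close> in the proof makes the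
  contradiction at an almost maximal point strict.\<close>

lemma harnack_quantity_nonpos:
  fixes G :: "'v wgraph"
  assumes G: "weighted_graph G" and n: "n > 0" and K: "K \<ge> 0" and CDE: "CDE G n (- K)"
    and u: "positive_heat_solution G u"
    and a: "\<And>t. t > 0 \<Longrightarrow> (a has_real_derivative a' t) (at t)" "\<And>t. t > 0 \<Longrightarrow> a t > 0"
      "\<And>t. t > 0 \<Longrightarrow> a' t > 0"
    and A: "\<And>t. t > 0 \<Longrightarrow> (A has_real_derivative a' t + 2 * K * a t) (at t)"
      "\<And>t. t > 0 \<Longrightarrow> A t \<ge> a t" "(A \<longlongrightarrow> 0) (at_right 0)"
    and B: "\<And>t. t > 0 \<Longrightarrow> (B has_real_derivative
        n * K * a' t + n * K\<^sup>2 * a t + n / 4 * ((a' t)\<^sup>2 / a t)) (at t)"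
      "\<And>t. t > 0 \<Longrightarrow> B t \<ge> 0"
    and T: "T > 0"
  shows "2 * a T * Gam G (\<lambda>y. sqrt (u y T)) (\<lambda>y. sqrt (u y T)) x
      - A T * Lap G (\<lambda>y. u y T) x - B T * u x T \<le> 0"
proof (rule ccontr)
  define f where "f = (\<lambda>y t. sqrt (u y t))"
  define Q where "Q = (\<lambda>x t. 2 * a t * Gam G (\<lambda>y. f y t) (\<lambda>y. f y t) x
      - A t * Lap G (\<lambda>y. u y t) x - B t * u x t)"
  assume "\<not> ?thesis"
  then have "Q x T > 0" by (simp add: Q_def f_def)
  have u_pos: "u y t > 0" and u_deriv: "(u y has_real_derivative Lap G (\<lambda>z. u z t) y) (at t)"
    if "t > 0" for y t
    using u that by (auto simp: positive_heat_solution_def)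
  have f_pos: "f y t > 0" and f_sq: "(f y t)\<^sup>2 = u y t" if "t > 0" for y t
    using u_pos[OF that, of y] by (auto simp: f_def)
  have Lap_u: "Lap G (\<lambda>y. u y t) z = 2 * f z t * Lap G (\<lambda>y. f y t) z
      + 2 * Gam G (\<lambda>y. f y t) (\<lambda>y. f y t) z" if "t > 0" for z t
    using Lap_power2[of G "\<lambda>y. f y t" z] f_sq[OF that] by simp
  obtain D where D: "D \<ge> 0" "\<And>x. wdeg G x \<le> D * vmeas G x" using wdeg_le_vmeas[OF G] by blast
  obtain W where W: "\<And>x y. y \<in> nbrs G x \<Longrightarrow> wdeg G x \<le> W * weight G x y"
    using wdeg_le_weight[OF G] by blast
  \<comment> \<open>This choice leaves \<open>H x T = Q x T / 2 > 0\<close>.\<close>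
  define \<epsilon> where "\<epsilon> = Q x T / u x T / (2 * T)"
  have \<epsilon>: "\<epsilon> > 0" using \<open>Q x T > 0\<close> u_pos[OF T] T by (simp add: \<epsilon>_def)
  define H where "H = (\<lambda>x t. Q x t - \<epsilon> * t * u x t)"
  define F where "F = (\<lambda>x t. H x t / u x t)"
  define H' where "H' = (\<lambda>x t. 2 * a' t * Gam G (\<lambda>y. f y t) (\<lambda>y. f y t) x
      + 4 * a t * Gam G (\<lambda>y. f y t) (\<lambda>y. Lap G (\<lambda>z. u z t) y / (2 * f y t)) x
      - (a' t + 2 * K * a t) * Lap G (\<lambda>y. u y t) x
      - A t * Lap G (\<lambda>y. Lap G (\<lambda>z. u z t) y) x
      - (n * K * a' t + n * K\<^sup>2 * a t + n / 4 * ((a' t)\<^sup>2 / a t) + \<epsilon>) * u x t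
      - (B t + \<epsilon> * t) * Lap G (\<lambda>y. u y t) x)"
  define F' where "F' = (\<lambda>x t. (H' x t * u x t - H x t * Lap G (\<lambda>y. u y t) x) / (u x t * u x t))"
  have f_deriv: "(f y has_real_derivative Lap G (\<lambda>z. u z t) y / (2 * f y t)) (at t)"
    if "t > 0" for y t
    unfolding f_def using u_pos[OF that, of y]
    by (auto intro!: derivative_eq_intros u_deriv that simp: field_simps)
  have H_deriv: "(H y has_real_derivative H' y t) (at t)" if "t > 0" for y t
    unfolding H_def Q_def H'_def
    by (rule derivative_eq_intros has_real_derivative_Gam has_real_derivative_Lap f_deriv u_deriv
        a(1) A(1) B(1) that refl)+ (simp add: algebra_simps)
  have F_deriv: "(F y has_real_derivative F' y t) (at t)" if "t > 0" for y t
    unfolding F_def F'_def using u_pos[OF that, of y]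
    by (intro DERIV_divide H_deriv u_deriv that) simp
  have H_le: "H y t \<le> 2 * A t * (- (f y t * Lap G (\<lambda>y. f y t) y))" if t: "t > 0" for y t
  proof -
    have "(A t - a t) * Gam G (\<lambda>y. f y t) (\<lambda>y. f y t) y \<ge> 0"
      using A(2)[OF t] Gam_nonneg[OF G] by simp
    moreover have "(B t + \<epsilon> * t) * u y t \<ge> 0"
      using B(2)[OF t] u_pos[OF t, of y] \<epsilon> t by simp
    ultimately show ?thesis unfolding H_def Q_def Lap_u[OF t] by (simp add: algebra_simps)
  qed
  have A_pos: "A t > 0" if "t > 0" for t using A(2)[OF that] a(2)[OF that] by simp
  have F_le: "F y t \<le> 2 * A t * D" if t: "t > 0" for y t
  proof -
    have "- Lap G (\<lambda>y. f y t) y \<le> D * f y t"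
      using f_pos[OF t] by (intro neg_Lap_le[OF G] D) (auto simp: less_imp_le)
    then have "f y t * (- Lap G (\<lambda>y. f y t) y) \<le> f y t * (D * f y t)"
      using f_pos[OF t, of y] by (intro mult_left_mono) auto
    then have "- (f y t * Lap G (\<lambda>y. f y t) y) \<le> D * u y t"
      using f_sq[OF t, of y] by (simp add: power2_eq_square mult_ac)
    then have "2 * A t * (- (f y t * Lap G (\<lambda>y. f y t) y)) \<le> 2 * A t * (D * u y t)"
      using A_pos[OF t] by (intro mult_left_mono) auto
    with H_le[OF t, of y] show ?thesis
      unfolding F_def using u_pos[OF t, of y] by (simp add: field_simps)
  qed
  have A_mono: "A t \<le> A T" if "0 < t" "t \<le> T" for t
  proof (rule DERIV_nonneg_imp_nondecreasing[OF that(2)])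
    fix s assume "t \<le> s" "s \<le> T"
    then have "s > 0" using that by simp
    then show "\<exists>y. (A has_real_derivative y) (at s) \<and> 0 \<le> y"
      using A(1)[of s] a(2,3)[of s] K by (intro exI[of _ "a' s + 2 * K * a s"]) auto
  qed
  have "((\<lambda>t. 2 * A t * D) \<longlongrightarrow> 2 * 0 * D) (at_right 0)" by (intro tendsto_intros A(3))
  then have lim: "((\<lambda>t. 2 * A t * D) \<longlongrightarrow> 0) (at_right 0)" by simp
  have x0: "F x T > 0"
    using \<open>Q x T > 0\<close> T u_pos[OF T, of x] by (simp add: F_def H_def \<epsilon>_def field_simps)
  \<comment> \<open>Makes the error \<eta> W^2 D u strictly smaller than \<epsilon> u; the
    \<open>+ 1\<close> keeps the denominator positive.\<close>
  define \<eta> where "\<eta> = \<epsilon> / (2 * (W\<^sup>2 * D + 1))"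
  have pos: "W\<^sup>2 * D + 1 > 0" using D(1) by (simp add: add_nonneg_pos)
  have \<eta>: "\<eta> > 0" using \<epsilon> pos by (simp add: \<eta>_def)
  obtain z t where t: "0 < t" and z: "F z t > 0" "F' z t \<ge> 0" "\<And>y. F y t \<le> F z t + \<eta>"
  proof (rule almost_maximum[where F = F and F' = F' and T = T and M = "2 * A T * D" and \<eta> = \<eta>])
    show "2 * A t * D \<le> 2 * A T * D" if "0 < t" "t \<le> T" for t
      using A_mono[OF that] D(1) by (intro mult_right_mono) auto
  qed (use F_deriv F_le lim T x0 \<eta> in auto)
  have uz: "u z t > 0" "f z t > 0" using u_pos f_pos t by auto
  have uF: "u y t * F y t = H y t" for y using u_pos[OF t, of y] by (simp add: F_def)
  have "H z t > 0" using z(1) uz by (simp add: F_def zero_less_divide_iff)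
  then have "2 * A t * (- (f z t * Lap G (\<lambda>y. f y t) z)) > 0" using H_le[OF t, of z] by simp
  \<comment> \<open>This sign is what both the curvature condition and the neighbour bound at
    \<open>z\<close> require.\<close>
  then have neg: "Lap G (\<lambda>y. f y t) z < 0"
    using A_pos[OF t] uz by (simp add: zero_less_mult_iff mult_less_0_iff)
  have H'_ge: "H' z t \<ge> F z t * Lap G (\<lambda>y. u y t) z"
  proof -
    have "H' z t * u z t - H z t * Lap G (\<lambda>y. u y t) z \<ge> 0"
      using z(2) uz by (simp add: F'_def zero_le_divide_iff mult_le_0_iff)
    then show ?thesis using uz by (simp add: F_def field_simps)
  qed
  have "Lap G (\<lambda>y. H y t) z \<le> F z t * Lap G (\<lambda>y. u y t) z
      + \<eta> * ((\<Sum>y\<in>nbrs G z. weight G z y * u y t) / vmeas G z)"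
    using Lap_mult_le[OF G, of "\<lambda>y. u y t" "\<lambda>y. F y t" z \<eta>] z(3) u_pos[OF t]
    by (simp add: uF less_imp_le)
  also have "(\<Sum>y\<in>nbrs G z. weight G z y * u y t) / vmeas G z \<le> W\<^sup>2 * D * u z t"
    using sum_weight_power2_le[OF G, of "\<lambda>y. f y t" z W D] f_pos[OF t] neg W D f_sq[OF t]
    by (simp add: less_imp_le)
  finally have "Lap G (\<lambda>y. H y t) z - H' z t \<le> \<eta> * (W\<^sup>2 * D * u z t)"
    using H'_ge \<eta> by simp
  also have "\<dots> < \<epsilon> * u z t"
  proof -
    have "\<eta> * (W\<^sup>2 * D) < \<eta> * (2 * (W\<^sup>2 * D + 1))"
      using \<eta> D(1) by (intro mult_strict_left_mono) (auto simp: add_nonneg_pos)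
    also have "\<dots> = \<epsilon>" using pos by (simp add: \<eta>_def)
    finally show ?thesis using uz by (simp add: mult.assoc[symmetric])
  qed
  finally have upper: "Lap G (\<lambda>y. H y t) z - H' z t < \<epsilon> * u z t" .
  have Lap_H: "Lap G (\<lambda>y. H y t) z = 2 * a t * Lap G (Gam G (\<lambda>y. f y t) (\<lambda>y. f y t)) z
      - A t * Lap G (\<lambda>y. Lap G (\<lambda>z. u z t) y) z - B t * Lap G (\<lambda>y. u y t) z
      - \<epsilon> * t * Lap G (\<lambda>y. u y t) z"
    unfolding H_def Q_def by (simp only: Lap_diff Lap_mult_const)
  \<comment> \<open>The terms with \<Delta>\<Delta>u and those with factor
    \<open>B t + \<epsilon> * t\<close> cancel. What remains is the expression of
    \<open>CDE_lower_bound\<close> plus \<epsilon> u, so it is at least \<epsilon> u, against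
    \<open>upper\<close>.\<close>
  have "Lap G (\<lambda>y. H y t) z - H' z t = 4 * a t * Gam2_tilde G (\<lambda>y. f y t) z
      - 2 * a' t * Gam G (\<lambda>y. f y t) (\<lambda>y. f y t) z
      + (a' t + 2 * K * a t) * Lap G (\<lambda>y. (f y t)\<^sup>2) z
      + (n * K * a' t + n * K\<^sup>2 * a t + n / 4 * ((a' t)\<^sup>2 / a t)) * (f z t)\<^sup>2 + \<epsilon> * u z t"
    unfolding Lap_H H'_def Gam2_tilde_def f_sq[OF t] by (simp add: algebra_simps)
  with CDE_lower_bound[OF CDE n, of "\<lambda>y. f y t" z "a t" "a' t"] f_pos[OF t] neg a(2)[OF t] upper
  show False by simp
qed

theorem theorem3p1:
  fixes G :: "'v wgraph" and n K :: real
    and u :: "'v \<Rightarrow> real \<Rightarrow> real" and a a' :: "real \<Rightarrow> real"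
  assumes "weighted_graph G"
    and "n > 0" and "K \<ge> 0"
    and "CDE G n (- K)"
    and "positive_heat_solution G u"
    and a_C1: "\<forall>t>0. (a has_real_derivative a' t) (at t)" "continuous_on {0<..} a'"
    and A1: "\<forall>t>0. a t > 0 \<and> a' t > 0"
      "(a \<longlongrightarrow> 0) (at_right 0)" "((\<lambda>t. a t / a' t) \<longlongrightarrow> 0) (at_right 0)"
    and A2: "\<forall>L>0. continuous_on {0<..L} (\<lambda>t. (a' t)\<^sup>2 / a t) \<and>
      (\<lambda>t. (a' t)\<^sup>2 / a t) integrable_on {0..L}"
  shows "\<forall>x. \<forall>t>0.
    Gam G (\<lambda>y. sqrt (u y t)) (\<lambda>y. sqrt (u y t)) x / u x t
      - LY_alpha K a t * (deriv (\<lambda>s. sqrt (u x s)) t / sqrt (u x t))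
    \<le> 1 / 2 * LY_phi n K a a' t"
proof (intro allI impI)
  fix x and t :: real
  assume t: "t > 0"
  let ?h = "\<lambda>t. (a' t)\<^sup>2 / a t"
  let ?\<Gamma> = "Gam G (\<lambda>y. sqrt (u y t)) (\<lambda>y. sqrt (u y t)) x"
  let ?L = "Lap G (\<lambda>y. u y t) x"
  define A where "A = (\<lambda>t. a t + 2 * K * integral {0..t} a)"
  define B where "B = (\<lambda>t. n * K * a t + n * K\<^sup>2 * integral {0..t} a + n / 4 * integral {0..t} ?h)"
  have a_cont: "continuous_on {0<..} a"
    using a_C1(1) by (intro continuous_at_imp_continuous_on ballI DERIV_isCont) auto
  have h_cont: "continuous_on {0<..} ?h"
    by (intro continuous_intros a_C1(2) a_cont) (use A1(1) in force)
  have a_int: "a integrable_on {0..L}" if "L > 0" for L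
    by (rule integrable_on_0_if_tendsto[OF a_cont A1(2) that])
  have h_int: "?h integrable_on {0..L}" if "L > 0" for L using A2 that by simp
  have a_nonneg: "integral {0..s} a \<ge> 0" if "s > 0" for s
    using A1(1) by (intro integral_0_nonneg a_int that) (auto simp: less_imp_le)
  have h_nonneg: "integral {0..s} ?h \<ge> 0" if "s > 0" for s
    using A1(1) by (intro integral_0_nonneg h_int that) (auto simp: less_imp_le)
  have u_pos: "u x t > 0" and u_deriv: "(u x has_real_derivative ?L) (at t)"
    using assms(5) t by (auto simp: positive_heat_solution_def)
  have "2 * a t * ?\<Gamma> - A t * ?L - B t * u x t \<le> 0"
  proof (rule harnack_quantity_nonpos[where a = a and a' = a' and A = A and B = B])
    fix s :: real
    assume s: "s > 0"
    show "(A has_real_derivative a' s + 2 * K * a s) (at s)"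
      unfolding A_def using a_C1(1) s
      by (auto intro!: derivative_eq_intros has_real_derivative_integral_0 a_int a_cont)
    show "(B has_real_derivative n * K * a' s + n * K\<^sup>2 * a s + n / 4 * ?h s) (at s)"
      unfolding B_def using a_C1(1) s
      by (auto intro!: derivative_eq_intros has_real_derivative_integral_0 a_int a_cont h_int h_cont)
    show "A s \<ge> a s" using a_nonneg[OF s] assms(3) by (simp add: A_def)
    show "B s \<ge> 0"
      using a_nonneg[OF s] h_nonneg[OF s] assms(2,3) A1(1) s
      by (auto simp: B_def less_imp_le intro!: add_nonneg_nonneg mult_nonneg_nonneg)
  next
    have "(A \<longlongrightarrow> 0 + 2 * K * 0) (at_right 0)"
      unfolding A_def by (intro tendsto_intros A1(2) integral_0_tendsto_0 a_int) simp
    then show "(A \<longlongrightarrow> 0) (at_right 0)" by simp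
  qed (use assms t in auto)
  moreover have "A t = a t * LY_alpha K a t" "B t = a t * LY_phi n K a a' t"
    using A1(1) t by (auto simp: A_def B_def LY_alpha_def LY_phi_def distrib_left less_imp_neq[symmetric])
  ultimately have "a t * (2 * ?\<Gamma> - LY_alpha K a t * ?L - LY_phi n K a a' t * u x t) \<le> 0"
    by (simp add: algebra_simps)
  then have main: "2 * ?\<Gamma> - LY_alpha K a t * ?L - LY_phi n K a a' t * u x t \<le> 0"
    using A1(1) t by (meson mult_pos_pos not_le)
  \<comment> \<open>Dividing this derivative by sqrt u gives \<Delta>u / (2 u), so the claim is
    \<open>main\<close> divided by 2 u.\<close>
  have "((\<lambda>s. sqrt (u x s)) has_real_derivative ?L / (2 * sqrt (u x t))) (at t)"
    using u_pos by (auto intro!: derivative_eq_intros u_deriv simp: field_simps)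
  then have deriv_eq: "deriv (\<lambda>s. sqrt (u x s)) t / sqrt (u x t) = ?L / (2 * u x t)"
    using u_pos by (simp add: DERIV_imp_deriv)
  show "?\<Gamma> / u x t - LY_alpha K a t * (deriv (\<lambda>s. sqrt (u x s)) t / sqrt (u x t))
      \<le> 1 / 2 * LY_phi n K a a' t"
    unfolding deriv_eq using main u_pos by (simp add: field_simps)
qed

end
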